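(* Let $\mu\in(0,1/2]$, and consider the planar circular restricted charged three-body problem with parameters $\mu,\beta_1,\beta_2$. \begin{enumerate} \item Let $(\beta_1,\beta_2)\in R'_2$. There are at most two collinear equilibrium solutions in each one of the intervals $I_1$, $I_2$. A collinear equilibrium solution with $x\in I_1$ exists if and only if there is $x_*<-\mu$ such that $$-\beta_1^*(x_*,\mu)\le\beta_1<0,\qquad \beta_2^*(x_*,\mu)\le\beta_2 .$$ A collinear equilibrium solution with $x\in I_2$ exists if and only if there is $x_*$ with $-\mu<x_*<x_{r1}(\mu)$ such that $$\beta_1^*(x_*,\mu)\le\beta_1<0,\qquad \frac{\beta_1^*(x_*,\mu)}{\beta_1^*(x_*,\mu)-1}<\beta_2\le\beta_2^*(x_*,\mu).$$ \item Let $(\beta_1,\beta_2)\in R'_4$. There are at most two collinear equilibrium solutions in each one of the intervals $I_3$, $I_2$. A collinear equilibrium solution with $x\in I_3$ exists if and only if there is $x_*>1-\mu$ such that $$-\beta_2^*(x_*,\mu)\le\beta_2<0,\qquad \beta_1^*(x_*,\mu)\le\beta_1 .$$ A collinear equilibrium solution with $x\in I_2$ exists if and only if there is $x_*$ with $x_{r2}(\mu)<x_*<1-\mu$ such that $$\beta_2^*(x_*,\mu)\le\beta_2<0,\qquad \frac{\beta_2^*(x_*,\mu)}{\beta_2^*(x_*,\mu)-1}<\beta_1\le\beta_1^*(x_*,\mu).$$ \end{enumerate}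
   Context: The collinear equilibrium solutions of the planar circular restricted charged three-body problem (parameters $\mu\in(0,1/2]$, $\beta_1,\beta_2\in\mathbb{R}$ with $(\beta_1-1)(\beta_2-1)<1$) are the points $(x,0)$, $x\in\mathbb{R}\setminus\{-\mu,1-\mu\}$, with $F(x)=0$, where $$F(x)=x-\frac{\beta_1(1-\mu)(x+\mu)}{\rho_1^3}-\frac{\beta_2\,\mu\,(x+\mu-1)}{\rho_2^3},\qquad \rho_1=|x+\mu|,\quad \rho_2=|x+\mu-1|.$$ Intervals: $I_1=(-\infty,-\mu)$, $I_2=(-\mu,1-\mu)$, $I_3=(1-\mu,\infty)$. Regions: $R'_2=\{\beta_1<0,\ \beta_2>0,\ (\beta_1-1)(\beta_2-1)<1\}$ and $R'_4=\{\beta_1>0,\ \beta_2<0,\ (\beta_1-1)(\beta_2-1)<1\}$. For $\mu\in(0,1)$ and $x_*\in\mathbb{R}$ put $$\beta_1^*(x_*,\mu)=\frac{(3x_*+\mu-1)(x_*+\mu)^3}{2(1-\mu)},\qquad \beta_2^*(x_*,\mu)=\frac{(3x_*+\mu)(x_*+\mu-1)^3}{2\mu},$$ $$G(x_*,\mu)=\beta_1^*(x_*,\mu)\beta_2^*(x_*,\mu)-\beta_1^*(x_*,\mu)-\beta_2^*(x_*,\mu).$$ For $\mu\in(0,1)$, $x_{r1}(\mu)$ denotes the root of $G(\cdot,\mu)$ in $(-\mu,-\mu/3)$, i.e. the value of $x_*\in(-\mu,-\mu/3)$ at which the curve $\beta_1=\beta_1^*(x_*,\mu)$, $\beta_2=\beta_2^*(x_*,\mu)$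 meets $\beta_1\beta_2-\beta_1-\beta_2=0$; and $x_{r2}(\mu)=-x_{r1}(1-\mu)$, which is a root of $G(\cdot,\mu)$ in $\left(\frac{1-\mu}{3},1-\mu\right)$. *)

theory Defs
  imports Complex_Main
begin

definition rho1 :: "real \<Rightarrow> real \<Rightarrow> real" where
  "rho1 \<mu> x = \<bar>x + \<mu>\<bar>"

definition rho2 :: "real \<Rightarrow> real \<Rightarrow> real" where
  "rho2 \<mu> x = \<bar>x + \<mu> - 1\<bar>"

definition F :: "real \<Rightarrow> real \<Rightarrow> real \<Rightarrow> real \<Rightarrow> real" where
  "F \<mu> \<beta>1 \<beta>2 x =
     x - \<beta>1 * (1 - \<mu>) * (x + \<mu>) / rho1 \<mu> x ^ 3
       - \<beta>2 * \<mu> * (x + \<mu> - 1) / rho2 \<mu> x ^ 3"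

text \<open>The primaries sit at \<open>x = -\<mu>\<close> and \<open>x = 1 - \<mu>\<close>; they have to be excluded explicitly,
  since there the corresponding term of \<open>F\<close> is a division by zero, hence \<open>0\<close> in HOL.\<close>

definition collinear_equilibria :: "real \<Rightarrow> real \<Rightarrow> real \<Rightarrow> (real \<times> real) set" where
  "collinear_equilibria \<mu> \<beta>1 \<beta>2 =
     {(x, y). y = 0 \<and> x \<notin> {- \<mu>, 1 - \<mu>} \<and> F \<mu> \<beta>1 \<beta>2 x = 0}"

definition equilibria_in :: "real \<Rightarrow> real \<Rightarrow> real \<Rightarrow> real set \<Rightarrow> (real \<times> real) set" where
  "equilibria_in \<mu> \<beta>1 \<beta>2 I = {p \<in> collinear_equilibria \<mu> \<beta>1 \<beta>2. fst p \<in> I}"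

definition I1 :: "real \<Rightarrow> real set" where
  "I1 \<mu> = {..< - \<mu>}"

definition I2 :: "real \<Rightarrow> real set" where
  "I2 \<mu> = {- \<mu> <..< 1 - \<mu>}"

definition I3 :: "real \<Rightarrow> real set" where
  "I3 \<mu> = {1 - \<mu> <..}"

definition R2' :: "(real \<times> real) set" where
  "R2' = {(\<beta>1, \<beta>2). \<beta>1 < 0 \<and> \<beta>2 > 0 \<and> (\<beta>1 - 1) * (\<beta>2 - 1) < 1}"

definition R4' :: "(real \<times> real) set" where
  "R4' = {(\<beta>1, \<beta>2). \<beta>1 > 0 \<and> \<beta>2 < 0 \<and> (\<beta>1 - 1) * (\<beta>2 - 1) < 1}"

definition beta1_star :: "real \<Rightarrow> real \<Rightarrow> real" where
  "beta1_star x \<mu> = (3 * x + \<mu> - 1) * (x + \<mu>) ^ 3 / (2 * (1 - \<mu>))"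

definition beta2_star :: "real \<Rightarrow> real \<Rightarrow> real" where
  "beta2_star x \<mu> = (3 * x + \<mu>) * (x + \<mu> - 1) ^ 3 / (2 * \<mu>)"

definition G :: "real \<Rightarrow> real \<Rightarrow> real" where
  "G x \<mu> = beta1_star x \<mu> * beta2_star x \<mu> - beta1_star x \<mu> - beta2_star x \<mu>"

text \<open>For \<open>0 < \<mu> < 1\<close> the description below picks out a unique real: on \<open>(-\<mu>, -\<mu>/3)\<close> both
  \<open>beta1_star\<close> and \<open>beta2_star\<close> are strictly decreasing, with \<open>beta1_star < 0 < beta2_star\<close>, so
  that \<open>G = 0\<close> iff \<open>beta2_star = beta1_star / (beta1_star - 1)\<close>, whose left-hand side is
  decreasing and whose right-hand side is increasing; moreover \<open>G\<close> is negative at \<open>-\<mu>\<close> and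
  positive at \<open>-\<mu>/3\<close>.\<close>

definition x_r1 :: "real \<Rightarrow> real" where
  "x_r1 \<mu> = (THE x. x \<in> {- \<mu> <..< - \<mu> / 3} \<and> G x \<mu> = 0)"

definition x_r2 :: "real \<Rightarrow> real" where
  "x_r2 \<mu> = - x_r1 (1 - \<mu>)"

end

theory Submission
  imports Defs
begin

text \<open>For \<open>\<beta>1 < 0 < \<beta>2\<close> the equilibria in \<open>I1\<close> and in \<open>I2\<close> are level sets of a strictly convex
  function of one variable, and everything follows from strict convexity, used in the form
  that the graph lies above its tangents.

  On \<open>I2\<close>, put \<open>u = x + \<mu>\<close>, \<open>k = - \<beta>1 (1 - \<mu>) > 0\<close> and \<open>c = \<beta>2 \<mu> > 0\<close>. There the force is
  \<open>F = u - \<mu> + k / u\<^sup>2 + c / (1 - u)\<^sup>2\<close>, visibly convex. On \<open>I1\<close>, put \<open>v = - \<mu> - x > 0\<close>. There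
  \<open>F\<close> is in general neither convex nor concave, but solving \<open>F = 0\<close> for \<open>c\<close> gives
  \<open>c = (1 + v)\<^sup>2 (\<mu> + v + k / v\<^sup>2)\<close>, whose right-hand side is convex. A level set of a strictly
  convex function has at most two elements, which gives the two counts.

  The curve \<open>(\<beta>1*, \<beta>2*)\<close>, with the first coordinate negated on \<open>I1\<close>, consists of the charges for
  which \<open>x\<^sub>*\<close> is a double root of \<open>F\<close>. So if \<open>\<beta>1\<close> is fixed and \<open>x\<^sub>*\<close> is chosen to have \<open>\<beta>1\<close> as the
  first coordinate, then \<open>x\<^sub>*\<close> is a critical point, hence by convexity the extremal point, and
  \<open>\<beta>2*\<close> is the extremal value of \<open>\<beta>2\<close> for which an equilibrium exists. This \<open>x\<^sub>*\<close> is the witness that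
  an equilibrium supplies (\<open>inner_tangency_with_given_charge\<close> for \<open>I2\<close>). Conversely \<open>F\<close> is monotone
  in both charges, so if \<open>(\<beta>1, \<beta>2)\<close> is on the correct side of a point of the curve in both
  coordinates, \<open>F\<close> has the correct sign at \<open>x\<^sub>*\<close>, and the intermediate value theorem
  gives an equilibrium.

  In the condition for \<open>I2\<close>, the constraint \<open>x\<^sub>* < x_r1\<close> and the lower bound on \<open>\<beta>2\<close> come from
  \<open>(\<beta>1 - 1)(\<beta>2 - 1) < 1\<close>: the witness has \<open>\<beta>1* = \<beta>1\<close> and \<open>\<beta>2* \<ge> \<beta>2\<close>, so that \<open>G < 0\<close> there, and
  \<open>G\<close> is increasing on \<open>[-\<mu>, -\<mu>/3]\<close> with root \<open>x_r1\<close>.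

  The region with \<open>\<beta>2 < 0 < \<beta>1\<close> is the mirror image under \<open>x \<mapsto> - x\<close>, \<open>\<mu> \<mapsto> 1 - \<mu>\<close> and exchange of
  the charges. Since this does not preserve \<open>\<mu> \<le> 1/2\<close>, the first region is treated
  for all \<open>0 < \<mu> < 1\<close>.\<close>

section \<open>Functions that lie strictly above their tangents\<close>

text \<open>The slope \<open>D\<close> is part of the data, so that the tangent inequality at a critical point
  reduces to the equation \<open>D w = 0\<close> between the charges and \<open>w\<close>.\<close>

definition above_tangents :: "(real \<Rightarrow> real) \<Rightarrow> (real \<Rightarrow> real) \<Rightarrow> real set \<Rightarrow> bool" where
  "above_tangents f D I \<longleftrightarrow> (\<forall>w\<in>I. \<forall>v\<in>I. v \<noteq> w \<longrightarrow> f w + D w * (v - w) < f v)"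

lemma finite_card_le_2_if_no_three:
  fixes S :: "real set"
  assumes no3: "\<And>a b c. a \<in> S \<Longrightarrow> b \<in> S \<Longrightarrow> c \<in> S \<Longrightarrow> a < b \<Longrightarrow> b < c \<Longrightarrow> False"
  shows "finite S \<and> card S \<le> 2"
proof (rule ccontr)
  assume "\<not> (finite S \<and> card S \<le> 2)"
  then have "infinite S \<or> 3 \<le> card S" by auto
  then obtain T where T: "T \<subseteq> S" "card T = 3"
    by (metis infinite_arbitrarily_large obtain_subset_with_card_n)
  then obtain a b c where "a \<in> S" "b \<in> S" "c \<in> S" "a \<noteq> b" "a \<noteq> c" "b \<noteq> c"
    by (auto simp: card_3_iff)
  then show False
    using no3 by (metis linorder_neq_iff)
qed

text \<open>Of three points at the same height, the tangent at the middle one would have to descend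
  in both directions.\<close>

lemma above_tangents_level_set:
  assumes "above_tangents f D I"
  shows "finite {v\<in>I. f v = l} \<and> card {v\<in>I. f v = l} \<le> 2"
proof (rule finite_card_le_2_if_no_three)
  fix a b c
  assume abc: "a \<in> {v\<in>I. f v = l}" "b \<in> {v\<in>I. f v = l}" "c \<in> {v\<in>I. f v = l}" "a < b" "b < c"
  then have "f b + D b * (x - b) < f x" if "x \<in> I" "x \<noteq> b" for x
    using assms that unfolding above_tangents_def by blast
  from this[of a] this[of c] abc have "D b * (a - b) < 0" "D b * (c - b) < 0" by auto
  with abc show False by (auto simp: mult_less_0_iff)
qed

lemma above_tangents_minimum:
  assumes "above_tangents f D I" "w \<in> I" "v \<in> I" "D w = 0"
  shows "f w \<le> f v"
  using assms by (cases "v = w") (force simp: above_tangents_def)+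

text \<open>The convexity of both inverse-square terms, obtained from a factorisation of the difference
  between function and tangent.\<close>

lemma inverse_square_above_tangent:
  fixes v w :: real
  assumes "0 < v" "0 < w" "v \<noteq> w"
  shows "1 / w^2 - 2 * (v - w) / w^3 < 1 / v^2"
proof -
  define a b where "a = 1 / v" and "b = 1 / w"
  have inv: "v * a = 1" "w * b = 1" using assms by (auto simp: a_def b_def)
  have "0 < (v - w)^2 * (w + 2 * v) * a^2 * b^3"
    using assms by (simp add: a_def b_def)
  also have "\<dots> = a^2 - (b^2 - 2 * (v - w) * b^3)"
    using inv by algebra
  finally show ?thesis by (simp add: a_def b_def power_divide)
qed

section \<open>The equilibrium equation on the two intervals\<close>

text \<open>The force between the primaries at distance \<open>u\<close> from the first one, with
  \<open>k = - \<beta>1 (1 - \<mu>)\<close> and \<open>c = \<beta>2 \<mu>\<close>.\<close>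

definition inner_force :: "real \<Rightarrow> real \<Rightarrow> real \<Rightarrow> real \<Rightarrow> real" where
  "inner_force \<mu> k c u = u - \<mu> + k / u^2 + c / (1 - u)^2"

text \<open>The value of \<open>\<beta>2 \<mu>\<close> that puts the equilibrium at distance \<open>v\<close> beyond the first primary.\<close>

definition outer_charge :: "real \<Rightarrow> real \<Rightarrow> real \<Rightarrow> real" where
  "outer_charge \<mu> k v = (1 + v)^2 * (\<mu> + v + k / v^2)"

lemma F_inner:
  assumes "0 < u" "u < 1"
  shows "F \<mu> \<beta>1 \<beta>2 (u - \<mu>) = inner_force \<mu> (- \<beta>1 * (1 - \<mu>)) (\<beta>2 * \<mu>) u"
  using assms
  by (simp add: F_def rho1_def rho2_def inner_force_def divide_simps power2_eq_square power3_eq_cube)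
     (simp add: algebra_simps)

lemma F_outer:
  assumes "0 < v"
  shows "F \<mu> \<beta>1 \<beta>2 (- \<mu> - v)
    = (\<beta>2 * \<mu> - outer_charge \<mu> (- \<beta>1 * (1 - \<mu>)) v) / (1 + v)^2"
proof -
  have "\<bar>- v\<bar> = v" "\<bar>- v - 1\<bar> = 1 + v" "1 + v \<noteq> 0" using assms by auto
  then show ?thesis using assms
    by (simp add: F_def rho1_def rho2_def outer_charge_def divide_simps power2_eq_square power3_eq_cube)
       algebra
qed

lemma inner_force_above_tangents:
  assumes "0 < k" "0 < c"
  shows "above_tangents (inner_force \<mu> k c) (\<lambda>w. 1 - 2 * k / w^3 + 2 * c / (1 - w)^3) {0<..<1}"
  unfolding above_tangents_def
proof (intro ballI impI)
  fix w v :: real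
  assume wv: "w \<in> {0<..<1}" "v \<in> {0<..<1}" "v \<noteq> w"
  have "k * (1 / w^2 - 2 * (v - w) / w^3) < k * (1 / v^2)"
    using wv assms by (intro mult_strict_left_mono inverse_square_above_tangent) auto
  moreover have "c * (1 / (1 - w)^2 - 2 * ((1 - v) - (1 - w)) / (1 - w)^3) < c * (1 / (1 - v)^2)"
    using wv assms by (intro mult_strict_left_mono inverse_square_above_tangent) auto
  ultimately show "inner_force \<mu> k c w + (1 - 2 * k / w^3 + 2 * c / (1 - w)^3) * (v - w)
      < inner_force \<mu> k c v"
    by (simp add: inner_force_def algebra_simps diff_divide_distrib add_divide_distrib)
qed

text \<open>Expanding, \<open>outer_charge \<mu> k v = (1 + v)\<^sup>2 (\<mu> + v) + k (1 + 2 / v + 1 / v\<^sup>2)\<close> is a sum of functions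
  that are convex for \<open>v > 0\<close>. In the second factor of the difference between function and tangent,
  \<open>v + 2 w + 2 + \<mu>\<close> is the contribution of the cubic, and the two terms with \<open>k\<close> are those of
  \<open>2 / v\<close> and \<open>1 / v\<^sup>2\<close>.\<close>

lemma outer_charge_above_tangents:
  assumes "0 < \<mu>" "0 < k"
  shows "above_tangents (outer_charge \<mu> k) (\<lambda>w. (1 + w) * (2 * \<mu> + 1 + 3 * w - 2 * k / w^3)) {0<..}"
  unfolding above_tangents_def
proof (intro ballI impI)
  fix w v :: real
  assume wv: "w \<in> {0<..}" "v \<in> {0<..}" "v \<noteq> w"
  define a b where "a = 1 / v" and "b = 1 / w"
  have inv: "v * a = 1" "w * b = 1" using wv by (auto simp: a_def b_def)
  have "0 < (v - w)^2 * (v + 2 * w + 2 + \<mu> + 2 * k * a * b^2 + k * (w + 2 * v) * a^2 * b^3)"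
    using wv assms by (intro mult_pos_pos add_pos_pos) (auto simp: a_def b_def)
  also have "\<dots> = (1 + v)^2 * (\<mu> + v + k * a^2)
      - ((1 + w)^2 * (\<mu> + w + k * b^2) + (1 + w) * (2 * \<mu> + 1 + 3 * w - 2 * k * b^3) * (v - w))"
    using inv by algebra
  also have "\<dots> = outer_charge \<mu> k v
      - (outer_charge \<mu> k w + (1 + w) * (2 * \<mu> + 1 + 3 * w - 2 * k / w^3) * (v - w))"
    by (simp add: outer_charge_def a_def b_def power_divide)
  finally show "outer_charge \<mu> k w + (1 + w) * (2 * \<mu> + 1 + 3 * w - 2 * k / w^3) * (v - w)
      < outer_charge \<mu> k v" by simp
qed

section \<open>The curve of double roots\<close>

lemma beta_star_inner:
  assumes "0 < \<mu>" "\<mu> < 1"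
  shows "beta1_star (u - \<mu>) \<mu> * (1 - \<mu>) = (3 * u - 2 * \<mu> - 1) * u^3 / 2"
    and "beta2_star (u - \<mu>) \<mu> * \<mu> = (2 * \<mu> - 3 * u) * (1 - u)^3 / 2"
proof -
  have cancel: "a / (2 * m) * m = a / 2" if "m \<noteq> 0" for a m :: real
    using that by simp
  show "beta1_star (u - \<mu>) \<mu> * (1 - \<mu>) = (3 * u - 2 * \<mu> - 1) * u^3 / 2"
    unfolding beta1_star_def using assms by (subst cancel) (simp, algebra)
  show "beta2_star (u - \<mu>) \<mu> * \<mu> = (2 * \<mu> - 3 * u) * (1 - u)^3 / 2"
    unfolding beta2_star_def using assms by (subst cancel) (simp, algebra)
qed

lemma beta_star_outer:
  assumes "0 < \<mu>" "\<mu> < 1"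
  shows "beta1_star (- \<mu> - v) \<mu> * (1 - \<mu>) = (3 * v + 2 * \<mu> + 1) * v^3 / 2"
    and "beta2_star (- \<mu> - v) \<mu> * \<mu> = (3 * v + 2 * \<mu>) * (1 + v)^3 / 2"
proof -
  have u: "- \<mu> - v = - v - \<mu>" by simp
  show "beta1_star (- \<mu> - v) \<mu> * (1 - \<mu>) = (3 * v + 2 * \<mu> + 1) * v^3 / 2"
    unfolding u beta_star_inner(1)[OF assms] by algebra
  show "beta2_star (- \<mu> - v) \<mu> * \<mu> = (3 * v + 2 * \<mu>) * (1 + v)^3 / 2"
    unfolding u beta_star_inner(2)[OF assms] by algebra
qed

text \<open>On the curve, both the force and its slope vanish at \<open>x\<^sub>*\<close>.\<close>

lemma inner_force_star:
  assumes "0 < u" "u < 1" "0 < \<mu>" "\<mu> < 1"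
  shows "inner_force \<mu> (- beta1_star (u - \<mu>) \<mu> * (1 - \<mu>)) (beta2_star (u - \<mu>) \<mu> * \<mu>) u = 0"
    and "1 - 2 * (- beta1_star (u - \<mu>) \<mu> * (1 - \<mu>)) / u^3
           + 2 * (beta2_star (u - \<mu>) \<mu> * \<mu>) / (1 - u)^3 = 0"
proof -
  have b1: "- beta1_star (u - \<mu>) \<mu> * (1 - \<mu>) = (2 * \<mu> + 1 - 3 * u) * u^3 / 2"
    using beta_star_inner(1)[OF assms(3,4), of u] by algebra
  note b2 = beta_star_inner(2)[OF assms(3,4), of u]
  have cancel: "c * a^3 / 2 / a^2 = c * a / 2" for a c :: real
    by (simp add: power2_eq_square power3_eq_cube)
  show "inner_force \<mu> (- beta1_star (u - \<mu>) \<mu> * (1 - \<mu>)) (beta2_star (u - \<mu>) \<mu> * \<mu>) u = 0"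
    unfolding inner_force_def b1 b2 cancel by (simp add: field_simps)
  show "1 - 2 * (- beta1_star (u - \<mu>) \<mu> * (1 - \<mu>)) / u^3
           + 2 * (beta2_star (u - \<mu>) \<mu> * \<mu>) / (1 - u)^3 = 0"
    unfolding b1 b2 using assms by simp
qed

text \<open>The second equation says that the slope of \<open>outer_charge\<close> vanishes, up to its positive
  factor \<open>1 + v\<close>.\<close>

lemma outer_charge_star:
  assumes "0 < v" "0 < \<mu>" "\<mu> < 1"
  shows "outer_charge \<mu> (beta1_star (- \<mu> - v) \<mu> * (1 - \<mu>)) v = beta2_star (- \<mu> - v) \<mu> * \<mu>"
    and "2 * \<mu> + 1 + 3 * v - 2 * (beta1_star (- \<mu> - v) \<mu> * (1 - \<mu>)) / v^3 = 0"
proof -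
  note b1 = beta_star_outer(1)[OF assms(2,3)] and b2 = beta_star_outer(2)[OF assms(2,3)]
  show "outer_charge \<mu> (beta1_star (- \<mu> - v) \<mu> * (1 - \<mu>)) v = beta2_star (- \<mu> - v) \<mu> * \<mu>"
    unfolding b1 b2 outer_charge_def using assms by (simp add: field_simps) algebra
  show "2 * \<mu> + 1 + 3 * v - 2 * (beta1_star (- \<mu> - v) \<mu> * (1 - \<mu>)) / v^3 = 0"
    unfolding b1 using assms by simp
qed

section \<open>Equilibria as level sets\<close>

lemma equilibria_in_eq_image:
  assumes "- \<mu> \<notin> I" "1 - \<mu> \<notin> I"
  shows "equilibria_in \<mu> \<beta>1 \<beta>2 I = (\<lambda>x. (x, 0)) ` {x\<in>I. F \<mu> \<beta>1 \<beta>2 x = 0}"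
  using assms by (auto simp: equilibria_in_def collinear_equilibria_def)

lemma inner_equilibria:
  "equilibria_in \<mu> \<beta>1 \<beta>2 (I2 \<mu>)
    = (\<lambda>u. (u - \<mu>, 0)) ` {u\<in>{0<..<1}. inner_force \<mu> (- \<beta>1 * (1 - \<mu>)) (\<beta>2 * \<mu>) u = 0}"
proof -
  have "{x\<in>I2 \<mu>. F \<mu> \<beta>1 \<beta>2 x = 0}
      = (\<lambda>u. u - \<mu>) ` {u\<in>{0<..<1}. inner_force \<mu> (- \<beta>1 * (1 - \<mu>)) (\<beta>2 * \<mu>) u = 0}" (is "?L = ?R")
  proof
    show "?R \<subseteq> ?L" by (auto simp: I2_def F_inner)
    show "?L \<subseteq> ?R"
    proof
      fix x assume "x \<in> ?L"
      then show "x \<in> ?R"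
        using F_inner[of "x + \<mu>" \<mu> \<beta>1 \<beta>2] by (intro image_eqI[of _ _ "x + \<mu>"]) (auto simp: I2_def)
    qed
  qed
  then show ?thesis
    by (subst equilibria_in_eq_image) (auto simp: I2_def)
qed

lemma outer_equilibria:
  "equilibria_in \<mu> \<beta>1 \<beta>2 (I1 \<mu>)
    = (\<lambda>v. (- \<mu> - v, 0)) ` {v\<in>{0<..}. outer_charge \<mu> (- \<beta>1 * (1 - \<mu>)) v = \<beta>2 * \<mu>}"
proof -
  have eq: "F \<mu> \<beta>1 \<beta>2 (- \<mu> - v) = 0 \<longleftrightarrow> outer_charge \<mu> (- \<beta>1 * (1 - \<mu>)) v = \<beta>2 * \<mu>"
    if "0 < v" for v
    using that by (auto simp: F_outer)
  have "{x\<in>I1 \<mu>. F \<mu> \<beta>1 \<beta>2 x = 0}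
      = (\<lambda>v. - \<mu> - v) ` {v\<in>{0<..}. outer_charge \<mu> (- \<beta>1 * (1 - \<mu>)) v = \<beta>2 * \<mu>}" (is "?L = ?R")
  proof
    show "?R \<subseteq> ?L" using eq by (auto simp: I1_def)
    show "?L \<subseteq> ?R"
    proof
      fix x assume "x \<in> ?L"
      then show "x \<in> ?R"
        using eq[of "- \<mu> - x"] by (intro image_eqI[of _ _ "- \<mu> - x"]) (auto simp: I1_def)
    qed
  qed
  then show ?thesis
    by (subst equilibria_in_eq_image) (auto simp: I1_def)
qed

lemma finite_card_image_le:
  assumes "finite S \<and> card S \<le> n"
  shows "finite (f ` S) \<and> card (f ` S) \<le> n"
  using assms card_image_le[of S f] by auto

section \<open>The root of \<open>G\<close>\<close>

lemma beta1_star_decreasing: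
  assumes "0 < \<mu>" "\<mu> < 1" "- \<mu> \<le> x" "x < y" "y \<le> - \<mu> / 3"
  shows "beta1_star y \<mu> < beta1_star x \<mu>"
proof -
  have der: "((\<lambda>x. beta1_star x \<mu>) has_real_derivative
      3 * (z + \<mu>)^2 * (4 * z + 2 * \<mu> - 1) / (2 * (1 - \<mu>))) (at z)" for z
    unfolding beta1_star_def
  proof (rule DERIV_cdivide)
    show "((\<lambda>x. (3 * x + \<mu> - 1) * (x + \<mu>)^3) has_real_derivative
        3 * (z + \<mu>)^2 * (4 * z + 2 * \<mu> - 1)) (at z)"
      by (rule derivative_eq_intros refl)+ (simp, algebra)
  qed
  show ?thesis
  proof (rule DERIV_neg_imp_decreasing_open[OF \<open>x < y\<close>])
    fix z assume z: "x < z" "z < y"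
    have "3 * (z + \<mu>)^2 * (4 * z + 2 * \<mu> - 1) / (2 * (1 - \<mu>)) < 0"
      using assms z by (intro divide_neg_pos mult_pos_neg) auto
    then show "\<exists>d. ((\<lambda>x. beta1_star x \<mu>) has_real_derivative d) (at z) \<and> d < 0"
      using der by blast
  qed (use assms in \<open>auto intro!: continuous_intros simp: beta1_star_def\<close>)
qed

lemma beta2_star_decreasing:
  assumes "0 < \<mu>" "\<mu> < 1" "x < y" "y \<le> - \<mu> / 3"
  shows "beta2_star y \<mu> < beta2_star x \<mu>"
proof -
  have "(1 - \<mu> - y)^3 < (1 - \<mu> - x)^3"
    using assms by (intro power_strict_mono) auto
  then have "(- 3 * y - \<mu>) * (1 - \<mu> - y)^3 < (- 3 * x - \<mu>) * (1 - \<mu> - x)^3"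
    using assms by (intro mult_strict_mono') auto
  moreover have "beta2_star z \<mu> = (- 3 * z - \<mu>) * (1 - \<mu> - z)^3 / (2 * \<mu>)" for z
  proof -
    have "(3 * z + \<mu>) * (z + \<mu> - 1)^3 = (- 3 * z - \<mu>) * (1 - \<mu> - z)^3" by algebra
    then show ?thesis by (simp add: beta2_star_def)
  qed
  ultimately show ?thesis
    using assms by (simp add: divide_strict_right_mono)
qed

text \<open>Both factors are increasing on \<open>[-\<mu>, -\<mu>/3]\<close> and non-negative, hence so is
  their product; this is what makes \<open>G\<close> monotone.\<close>

lemma G_eq: "G x \<mu> = (1 - beta1_star x \<mu>) * (1 - beta2_star x \<mu>) - 1"
  by (simp add: G_def algebra_simps)

lemma star_at_ends:
  assumes "0 < \<mu>" "\<mu> < 1"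
  shows "beta1_star (- \<mu>) \<mu> = 0" "beta2_star (- \<mu>) \<mu> = 1"
    "beta1_star (- (\<mu> / 3)) \<mu> * (1 - \<mu>) = - (4 * \<mu>^3 / 27)" "beta2_star (- (\<mu> / 3)) \<mu> = 0"
proof -
  have u: "- (\<mu> / 3) = 2 * \<mu> / 3 - \<mu>" by simp
  show "beta1_star (- (\<mu> / 3)) \<mu> * (1 - \<mu>) = - (4 * \<mu>^3 / 27)"
    unfolding u beta_star_inner[OF assms] by (simp add: power3_eq_cube)
qed (use assms in \<open>auto simp: beta1_star_def beta2_star_def\<close>)

lemma G_increasing:
  assumes "0 < \<mu>" "\<mu> < 1" "- \<mu> \<le> x" "x < y" "y \<le> - \<mu> / 3"
  shows "G x \<mu> < G y \<mu>"
proof -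
  have "beta1_star x \<mu> \<le> 0"
    using beta1_star_decreasing[of \<mu> "- \<mu>" x] star_at_ends[OF assms(1,2)] assms by (cases "x = - \<mu>") auto
  moreover have "beta2_star x \<mu> \<le> 1"
    using beta2_star_decreasing[of \<mu> "- \<mu>" x] star_at_ends[OF assms(1,2)] assms by (cases "x = - \<mu>") auto
  ultimately show ?thesis
    unfolding G_eq
    using beta1_star_decreasing[OF assms] beta2_star_decreasing[of \<mu> x y] assms
    by (simp add: mult_strict_mono')
qed

lemma x_r1_root:
  assumes "0 < \<mu>" "\<mu> < 1"
  shows "x_r1 \<mu> \<in> {- \<mu> <..< - \<mu> / 3} \<and> G (x_r1 \<mu>) \<mu> = 0"
proof -
  have ends: "G (- \<mu>) \<mu> < 0" "0 < G (- \<mu> / 3) \<mu>"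
    using assms beta1_star_decreasing[of \<mu> "- \<mu>" "- \<mu> / 3"] by (auto simp: G_eq star_at_ends)
  have cont: "continuous_on {- \<mu> .. - \<mu> / 3} (\<lambda>x. G x \<mu>)"
    unfolding G_def beta1_star_def beta2_star_def using assms by (intro continuous_intros) auto
  obtain x where x: "- \<mu> \<le> x" "x \<le> - \<mu> / 3" "G x \<mu> = 0"
    using IVT'[of "\<lambda>x. G x \<mu>" "- \<mu>" 0 "- \<mu> / 3", OF _ _ _ cont] ends assms by auto
  then have root: "x \<in> {- \<mu> <..< - \<mu> / 3} \<and> G x \<mu> = 0"
    using ends by (auto simp: less_le)
  show ?thesis
    unfolding x_r1_def
  proof (rule theI[where P = "\<lambda>x. x \<in> {- \<mu> <..< - \<mu> / 3} \<and> G x \<mu> = 0", OF root])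
    fix y assume "y \<in> {- \<mu> <..< - \<mu> / 3} \<and> G y \<mu> = 0"
    then show "y = x"
      using root G_increasing[of \<mu> x y] G_increasing[of \<mu> y x] assms
      by (cases x y rule: linorder_cases) auto
  qed
qed

lemma less_x_r1_if_G_neg:
  assumes "0 < \<mu>" "\<mu> < 1" "- \<mu> < x" "x < - \<mu> / 3" "G x \<mu> < 0"
  shows "x < x_r1 \<mu>"
proof (rule ccontr)
  assume "\<not> x < x_r1 \<mu>"
  then show False
    using G_increasing[of \<mu> "x_r1 \<mu>" x] x_r1_root[of \<mu>] assms by (cases "x = x_r1 \<mu>") auto
qed

section \<open>Existence of equilibria for \<open>\<beta>1 < 0 < \<beta>2\<close>\<close>

text \<open>An equilibrium at \<open>u\<close> forces \<open>k < (\<mu> - u) u\<^sup>2\<close>. The maximum of the right-hand side over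
  \<open>u > 0\<close> is \<open>4 \<mu>\<^sup>3 / 27\<close>, at \<open>u = 2 \<mu> / 3\<close>, and this is exactly the value of \<open>k\<close> on the curve at
  \<open>x = - \<mu> / 3\<close>, where \<open>\<beta>2*\<close> changes sign. So the curve reaches the given \<open>\<beta>1\<close> before
  \<open>- \<mu> / 3\<close>, while \<open>\<beta>2*\<close> is still positive. With the charges \<open>(\<beta>1, \<beta>2*)\<close> the force
  is convex with minimum \<open>0\<close>, and comparison with the force for \<open>(\<beta>1, \<beta>2)\<close> at \<open>u\<close> gives
  \<open>\<beta>2 \<le> \<beta>2*\<close>.\<close>

lemma inner_tangency_with_given_charge:
  assumes mu: "0 < \<mu>" "\<mu> < 1" and b: "\<beta>1 < 0" "\<beta>2 > 0"
    and u: "0 < u" "u < 1" "inner_force \<mu> (- \<beta>1 * (1 - \<mu>)) (\<beta>2 * \<mu>) u = 0"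
  obtains x where "- \<mu> < x" "x < - \<mu> / 3" "beta1_star x \<mu> = \<beta>1" "\<beta>2 \<le> beta2_star x \<mu>"
proof -
  define k where "k = - \<beta>1 * (1 - \<mu>)"
  have k: "0 < k" using mu b by (simp add: k_def mult_neg_pos)
  have "0 < \<beta>2 * \<mu> / (1 - u)^2" using mu b u by simp
  then have "k / u^2 < \<mu> - u"
    using u(3) unfolding inner_force_def k_def[symmetric] by linarith
  then have "k < (\<mu> - u) * u^2" using u by (simp add: field_simps)
  also have "\<dots> = 4 * \<mu>^3 / 27 - (u - 2 * \<mu> / 3)^2 * (u + \<mu> / 3)"
    by (simp add: power2_eq_square power3_eq_cube field_simps)
  also have "\<dots> \<le> 4 * \<mu>^3 / 27" using u mu by simp
  finally have "beta1_star (- (\<mu> / 3)) \<mu> * (1 - \<mu>) < \<beta>1 * (1 - \<mu>)"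
    using star_at_ends(3)[OF mu] by (simp add: k_def)
  then have ends: "beta1_star (- \<mu> / 3) \<mu> < \<beta>1" "\<beta>1 < beta1_star (- \<mu>) \<mu>"
    using star_at_ends(1)[OF mu] b mu by auto
  have "continuous_on {- \<mu> .. - \<mu> / 3} (\<lambda>x. beta1_star x \<mu>)"
    unfolding beta1_star_def using mu by (intro continuous_intros) auto
  then obtain x where "- \<mu> \<le> x" "x \<le> - \<mu> / 3" and x1: "beta1_star x \<mu> = \<beta>1"
    using IVT2'[of "\<lambda>x. beta1_star x \<mu>" "- \<mu> / 3" \<beta>1 "- \<mu>"] ends mu by auto
  then have x: "- \<mu> < x" "x < - \<mu> / 3"
    using ends by (auto simp: less_le)
  define w where "w = x + \<mu>"
  have w: "0 < w" "w < 1" "x = w - \<mu>" using x mu by (auto simp: w_def)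
  define c where "c = beta2_star x \<mu> * \<mu>"
  have "0 < c"
    using beta2_star_decreasing[of \<mu> x "- \<mu> / 3"] star_at_ends[OF mu] x mu by (simp add: c_def)
  note star = inner_force_star[OF w(1,2) mu, folded w(3), unfolded x1, folded k_def c_def]
  have "inner_force \<mu> k c w \<le> inner_force \<mu> k c u"
    using above_tangents_minimum[OF inner_force_above_tangents[OF k \<open>0 < c\<close>]] star(2) w u by auto
  then have "inner_force \<mu> k (\<beta>2 * \<mu>) u \<le> inner_force \<mu> k c u"
    using star(1) u(3) unfolding k_def[symmetric] by simp
  then have "\<beta>2 * \<mu> \<le> c"
    using u by (simp add: inner_force_def divide_le_cancel split: if_splits)
  then have "\<beta>2 \<le> beta2_star x \<mu>" using mu by (simp add: c_def)
  with x x1 show thesis using that by blast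
qed

lemma inner_force_zero_if_nonpos:
  assumes "0 < \<mu>" "0 < k" "0 < c" and u: "0 < u" "u < 1" "inner_force \<mu> k c u \<le> 0"
  obtains w where "0 < w" "w < 1" "inner_force \<mu> k c w = 0"
proof -
  \<comment> \<open>Close to the first primary its repulsion wins: \<open>z\<close> is small enough for \<open>k / z\<^sup>2 \<ge> \<mu>\<close>.\<close>
  define z where "z = min u (k / \<mu>)"
  have "0 < z" using assms(1,2) u(1) by (simp add: z_def)
  moreover have "z \<le> u" "z \<le> k / \<mu>" by (simp_all only: z_def min.cobounded1 min.cobounded2)
  ultimately have z: "0 < z" "z \<le> u" "z < 1" "z * \<mu> \<le> k"
    using assms(1) u(2) by (simp_all only: pos_le_divide_eq)
  have "\<mu> * z^2 = (z * \<mu>) * z" by (simp add: power2_eq_square)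
  also have "\<dots> \<le> k * z" using z by (intro mult_right_mono) auto
  also have "\<dots> \<le> k" using z assms by simp
  finally have "\<mu> \<le> k / z^2" using z by (simp add: field_simps)
  then have "0 \<le> inner_force \<mu> k c z"
    using z assms by (simp add: inner_force_def)
  moreover have "continuous_on {z..u} (inner_force \<mu> k c)"
    unfolding inner_force_def using z u by (intro continuous_intros) auto
  ultimately obtain w where w: "z \<le> w" "w \<le> u" "inner_force \<mu> k c w = 0"
    using IVT2'[of "inner_force \<mu> k c" u 0 z] u z by auto
  show thesis using z(1) u(2) w by (intro that[of w]) auto
qed

lemma inner_force_mono:
  assumes "k \<le> k'" "c \<le> c'"
  shows "inner_force \<mu> k c u \<le> inner_force \<mu> k' c' u"
  using assms by (simp add: inner_force_def add_mono divide_right_mono)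

lemma inner_equilibrium_iff:
  assumes mu: "0 < \<mu>" "\<mu> < 1" and R: "(\<beta>1, \<beta>2) \<in> R2'"
  shows "(\<exists>p. p \<in> equilibria_in \<mu> \<beta>1 \<beta>2 (I2 \<mu>)) \<longleftrightarrow>
          (\<exists>x. - \<mu> < x \<and> x < x_r1 \<mu> \<and>
               beta1_star x \<mu> \<le> \<beta>1 \<and> \<beta>1 < 0 \<and>
               beta1_star x \<mu> / (beta1_star x \<mu> - 1) < \<beta>2 \<and> \<beta>2 \<le> beta2_star x \<mu>)"
    (is "?L \<longleftrightarrow> ?R")
proof
  have b: "\<beta>1 < 0" "0 < \<beta>2" "(\<beta>1 - 1) * (\<beta>2 - 1) < 1" using R by (auto simp: R2'_def)
  {
    assume ?L
    then obtain u where "0 < u" "u < 1" "inner_force \<mu> (- \<beta>1 * (1 - \<mu>)) (\<beta>2 * \<mu>) u = 0"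
      by (auto simp: inner_equilibria)
    then obtain x where x: "- \<mu> < x" "x < - \<mu> / 3" "beta1_star x \<mu> = \<beta>1" "\<beta>2 \<le> beta2_star x \<mu>"
      using inner_tangency_with_given_charge[OF mu b(1,2)] by blast
    have "(1 - \<beta>1) * (1 - beta2_star x \<mu>) \<le> (1 - \<beta>1) * (1 - \<beta>2)"
      using x b by (intro mult_left_mono) auto
    also have "\<dots> < 1" using b(3) by (simp add: algebra_simps)
    finally have "x < x_r1 \<mu>"
      using less_x_r1_if_G_neg[of \<mu> x] mu x by (simp add: G_eq)
    moreover have "\<beta>1 / (\<beta>1 - 1) < \<beta>2"
      using b by (simp add: field_simps)
    ultimately show ?R using x b by auto
  }
  {
    assume ?R
    then obtain x where x: "- \<mu> < x" "x < x_r1 \<mu>" "beta1_star x \<mu> \<le> \<beta>1" "\<beta>2 \<le> beta2_star x \<mu>"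
      by blast
    define u where "u = x + \<mu>"
    have u: "0 < u" "u < 1" "u - \<mu> = x" using x x_r1_root[OF mu] mu by (auto simp: u_def)
    have "- \<beta>1 * (1 - \<mu>) \<le> - beta1_star x \<mu> * (1 - \<mu>)" "\<beta>2 * \<mu> \<le> beta2_star x \<mu> * \<mu>"
      using x mu by (auto intro: mult_right_mono)
    from inner_force_mono[OF this]
    have "inner_force \<mu> (- \<beta>1 * (1 - \<mu>)) (\<beta>2 * \<mu>) u \<le> 0"
      using inner_force_star(1)[OF u(1,2) mu] u by metis
    then obtain w where "0 < w" "w < 1" "inner_force \<mu> (- \<beta>1 * (1 - \<mu>)) (\<beta>2 * \<mu>) w = 0"
      using inner_force_zero_if_nonpos[of \<mu> "- \<beta>1 * (1 - \<mu>)" "\<beta>2 * \<mu>" u] u mu b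
      by (auto simp: mult_neg_pos)
    then show ?L by (auto simp: inner_equilibria)
  }
qed

lemma outer_equilibrium_iff:
  assumes mu: "0 < \<mu>" "\<mu> < 1" and b: "\<beta>1 < 0" "\<beta>2 > 0"
  shows "(\<exists>p. p \<in> equilibria_in \<mu> \<beta>1 \<beta>2 (I1 \<mu>)) \<longleftrightarrow>
          (\<exists>x. x < - \<mu> \<and> - beta1_star x \<mu> \<le> \<beta>1 \<and> \<beta>1 < 0 \<and> beta2_star x \<mu> \<le> \<beta>2)"
    (is "?L \<longleftrightarrow> ?R")
proof
  define k where "k = - \<beta>1 * (1 - \<mu>)"
  have k: "0 < k" using mu b by (simp add: k_def mult_neg_pos)
  {
    assume ?L
    then obtain v where v: "0 < v" "outer_charge \<mu> k v = \<beta>2 * \<mu>"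
      by (auto simp: outer_equilibria k_def)
    \<comment> \<open>The first charge along the curve, going outwards. It starts at \<open>0\<close> and is at least \<open>w\<^sup>3\<close>
      for \<open>w \<ge> 1\<close>, so it has reached \<open>k\<close> by the time \<open>w = 1 + k\<close>.\<close>
    define t where "t = (\<lambda>w. beta1_star (- \<mu> - w) \<mu> * (1 - \<mu>))"
    have t: "t w = (3 * w + 2 * \<mu> + 1) * w^3 / 2" for w
      using beta_star_outer(1)[OF mu] by (simp add: t_def)
    have "(1 + k) * 1 \<le> (1 + k) * (1 + k)^2"
      using k by (intro mult_left_mono one_le_power) auto
    then have "1 + k \<le> (1 + k)^3" by (simp add: power2_eq_square power3_eq_cube)
    moreover have "2 * (1 + k)^3 \<le> (3 * (1 + k) + 2 * \<mu> + 1) * (1 + k)^3"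
      using k mu by (intro mult_right_mono) auto
    ultimately have "k \<le> t (1 + k)" unfolding t by linarith
    moreover have "continuous_on {0..1 + k} t"
      unfolding t by (intro continuous_intros) auto
    ultimately obtain w where w: "0 \<le> w" "t w = k"
      using IVT'[of t 0 k "1 + k"] k by (auto simp: t)
    have "w \<noteq> 0" using w(2) k unfolding t by (intro notI) simp
    with w(1) have "0 < w" by simp
    note star = outer_charge_star[OF \<open>0 < w\<close> mu, folded t_def]
    have "outer_charge \<mu> k w \<le> outer_charge \<mu> k v"
      using above_tangents_minimum[OF outer_charge_above_tangents[OF mu(1) k], of w v]
        star w v \<open>0 < w\<close> by (auto simp: t_def)
    then have "beta2_star (- \<mu> - w) \<mu> * \<mu> \<le> \<beta>2 * \<mu>"
      using star(1) w v by (simp add: t_def)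
    moreover have "- beta1_star (- \<mu> - w) \<mu> * (1 - \<mu>) = \<beta>1 * (1 - \<mu>)"
      using w(2) unfolding t_def k_def by linarith
    then have "- beta1_star (- \<mu> - w) \<mu> = \<beta>1"
      using mu by (metis mult_right_cancel diff_gt_0_iff_gt less_irrefl)
    ultimately show ?R using \<open>0 < w\<close> mu b by (intro exI[of _ "- \<mu> - w"]) auto
  }
  {
    assume ?R
    then obtain x where x: "x < - \<mu>" "- beta1_star x \<mu> \<le> \<beta>1" "beta2_star x \<mu> \<le> \<beta>2" by blast
    define v where "v = - \<mu> - x"
    have v: "0 < v" "- \<mu> - v = x" using x by (auto simp: v_def)
    have "k \<le> beta1_star x \<mu> * (1 - \<mu>)"
      unfolding k_def using x mu by (intro mult_right_mono) auto
    then have "outer_charge \<mu> k v \<le> outer_charge \<mu> (beta1_star x \<mu> * (1 - \<mu>)) v"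
      by (simp add: outer_charge_def mult_left_mono divide_right_mono)
    also have "\<dots> \<le> \<beta>2 * \<mu>"
      using outer_charge_star(1)[OF v(1) mu] v x mu by simp
    finally have le: "outer_charge \<mu> k v \<le> \<beta>2 * \<mu>" .
    \<comment> \<open>Since \<open>outer_charge \<mu> k z \<ge> z\<close>, the level \<open>\<beta>2 \<mu>\<close> is reached by this point at the latest.\<close>
    define z where "z = max v (\<beta>2 * \<mu>)"
    have z: "v \<le> z" "\<beta>2 * \<mu> \<le> z" by (auto simp: z_def)
    have "0 \<le> k / z^2" using k by simp
    then have "\<beta>2 * \<mu> \<le> 1 * (\<mu> + z + k / z^2)" using z mu by simp
    also have "\<dots> \<le> outer_charge \<mu> k z"
      unfolding outer_charge_def using z v mu k by (intro mult_right_mono one_le_power) auto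
    finally have "\<beta>2 * \<mu> \<le> outer_charge \<mu> k z" .
    moreover have "continuous_on {v..z} (outer_charge \<mu> k)"
      unfolding outer_charge_def using v by (intro continuous_intros) auto
    ultimately obtain w where "v \<le> w" "outer_charge \<mu> k w = \<beta>2 * \<mu>"
      using IVT'[of "outer_charge \<mu> k" v "\<beta>2 * \<mu>" z] le z by auto
    then show ?L using v by (auto simp: outer_equilibria k_def intro!: exI[of _ w])
  }
qed

lemma region2:
  assumes mu: "0 < \<mu>" "\<mu> < 1" and R: "(\<beta>1, \<beta>2) \<in> R2'"
  shows
    "finite (equilibria_in \<mu> \<beta>1 \<beta>2 (I1 \<mu>)) \<and> card (equilibria_in \<mu> \<beta>1 \<beta>2 (I1 \<mu>)) \<le> 2 \<and>
     finite (equilibria_in \<mu> \<beta>1 \<beta>2 (I2 \<mu>)) \<and> card (equilibria_in \<mu> \<beta>1 \<beta>2 (I2 \<mu>)) \<le> 2 \<and>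
     ((\<exists>p. p \<in> equilibria_in \<mu> \<beta>1 \<beta>2 (I1 \<mu>)) \<longleftrightarrow>
       (\<exists>x. x < - \<mu> \<and> - beta1_star x \<mu> \<le> \<beta>1 \<and> \<beta>1 < 0 \<and> beta2_star x \<mu> \<le> \<beta>2)) \<and>
     ((\<exists>p. p \<in> equilibria_in \<mu> \<beta>1 \<beta>2 (I2 \<mu>)) \<longleftrightarrow>
       (\<exists>x. - \<mu> < x \<and> x < x_r1 \<mu> \<and> beta1_star x \<mu> \<le> \<beta>1 \<and> \<beta>1 < 0 \<and>
            beta1_star x \<mu> / (beta1_star x \<mu> - 1) < \<beta>2 \<and> \<beta>2 \<le> beta2_star x \<mu>))"
proof -
  have b: "\<beta>1 < 0" "0 < \<beta>2" using R by (auto simp: R2'_def)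
  then have k: "0 < - \<beta>1 * (1 - \<mu>)" and c: "0 < \<beta>2 * \<mu>" using mu by (auto simp: mult_neg_pos)
  have "finite (equilibria_in \<mu> \<beta>1 \<beta>2 (I1 \<mu>)) \<and> card (equilibria_in \<mu> \<beta>1 \<beta>2 (I1 \<mu>)) \<le> 2"
    unfolding outer_equilibria
    by (intro finite_card_image_le above_tangents_level_set[OF outer_charge_above_tangents[OF mu(1) k]])
  moreover have "finite (equilibria_in \<mu> \<beta>1 \<beta>2 (I2 \<mu>)) \<and> card (equilibria_in \<mu> \<beta>1 \<beta>2 (I2 \<mu>)) \<le> 2"
    unfolding inner_equilibria
    by (intro finite_card_image_le above_tangents_level_set[OF inner_force_above_tangents[OF k c]])
  ultimately show ?thesis
    using inner_equilibrium_iff[OF mu R] outer_equilibrium_iff[OF mu b] by blast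
qed

section \<open>Exchanging the primaries\<close>

lemma F_reflect: "F (1 - \<mu>) \<beta>2 \<beta>1 (- x) = - F \<mu> \<beta>1 \<beta>2 x"
proof -
  have "rho1 (1 - \<mu>) (- x) = rho2 \<mu> x" "rho2 (1 - \<mu>) (- x) = rho1 \<mu> x"
    by (auto simp: rho1_def rho2_def)
  then show ?thesis
    by (simp add: F_def algebra_simps diff_divide_distrib add_divide_distrib)
qed

text \<open>One inclusion, applied to the reflected problem, is the other one, because the reflection is
  an involution.\<close>

lemma equilibria_in_reflect:
  "equilibria_in \<mu> \<beta>1 \<beta>2 (uminus ` I) = (\<lambda>(x, y). (- x, y)) ` equilibria_in (1 - \<mu>) \<beta>2 \<beta>1 I"
  (is "?L = ?h ` ?R")
proof
  have swap: "?h p \<in> equilibria_in \<nu> b a (uminus ` J)" if "p \<in> equilibria_in (1 - \<nu>) a b J"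
    for p J and \<nu> a b :: real
    using that F_reflect[of \<nu> a b "- fst p"]
    by (cases p) (auto simp: equilibria_in_def collinear_equilibria_def)
  then show "?h ` ?R \<subseteq> ?L" by blast
  show "?L \<subseteq> ?h ` ?R"
  proof
    fix p assume "p \<in> ?L"
    then have "?h p \<in> ?R"
      using swap[of p "1 - \<mu>" \<beta>1 \<beta>2 "uminus ` I"] by (simp add: image_image)
    then show "p \<in> ?h ` ?R" by (intro image_eqI[of _ _ "?h p"]) (auto split: prod.splits)
  qed
qed

lemma beta_star_reflect:
  "beta1_star (- x) (1 - \<mu>) = beta2_star x \<mu>" "beta2_star (- x) (1 - \<mu>) = beta1_star x \<mu>"
proof -
  have "(3 * - x + (1 - \<mu>) - 1) * (- x + (1 - \<mu>))^3 = (3 * x + \<mu>) * (x + \<mu> - 1)^3" by algebra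
  then show "beta1_star (- x) (1 - \<mu>) = beta2_star x \<mu>"
    by (simp add: beta1_star_def beta2_star_def)
  have "(3 * - x + (1 - \<mu>)) * (- x + (1 - \<mu>) - 1)^3 = (3 * x + \<mu> - 1) * (x + \<mu>)^3" by algebra
  then show "beta2_star (- x) (1 - \<mu>) = beta1_star x \<mu>"
    by (simp add: beta1_star_def beta2_star_def)
qed

lemma region4:
  assumes mu: "0 < \<mu>" "\<mu> < 1" and R: "(\<beta>1, \<beta>2) \<in> R4'"
  shows
    "finite (equilibria_in \<mu> \<beta>1 \<beta>2 (I3 \<mu>)) \<and> card (equilibria_in \<mu> \<beta>1 \<beta>2 (I3 \<mu>)) \<le> 2 \<and>
        finite (equilibria_in \<mu> \<beta>1 \<beta>2 (I2 \<mu>)) \<and> card (equilibria_in \<mu> \<beta>1 \<beta>2 (I2 \<mu>)) \<le> 2 \<and>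
        ((\<exists>p. p \<in> equilibria_in \<mu> \<beta>1 \<beta>2 (I3 \<mu>)) \<longleftrightarrow>
          (\<exists>x. 1 - \<mu> < x \<and>
               - beta2_star x \<mu> \<le> \<beta>2 \<and> \<beta>2 < 0 \<and>
               beta1_star x \<mu> \<le> \<beta>1)) \<and>
        ((\<exists>p. p \<in> equilibria_in \<mu> \<beta>1 \<beta>2 (I2 \<mu>)) \<longleftrightarrow>
          (\<exists>x. x_r2 \<mu> < x \<and> x < 1 - \<mu> \<and>
               beta2_star x \<mu> \<le> \<beta>2 \<and> \<beta>2 < 0 \<and>
               beta2_star x \<mu> / (beta2_star x \<mu> - 1) < \<beta>1 \<and> \<beta>1 \<le> beta1_star x \<mu>))"
proof -
  have nu: "0 < 1 - \<mu>" "1 - \<mu> < 1" using mu by auto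
  have R2: "(\<beta>2, \<beta>1) \<in> R2'" and b: "\<beta>2 < 0" "0 < \<beta>1"
    using R by (auto simp: R2'_def R4'_def mult.commute)
  have I: "I3 \<mu> = uminus ` I1 (1 - \<mu>)" "I2 \<mu> = uminus ` I2 (1 - \<mu>)"
    by (auto simp: I1_def I2_def I3_def)
  have eqv: "equilibria_in \<mu> \<beta>1 \<beta>2 (I3 \<mu>) = (\<lambda>(x, y). (- x, y)) ` equilibria_in (1 - \<mu>) \<beta>2 \<beta>1 (I1 (1 - \<mu>))"
    "equilibria_in \<mu> \<beta>1 \<beta>2 (I2 \<mu>) = (\<lambda>(x, y). (- x, y)) ` equilibria_in (1 - \<mu>) \<beta>2 \<beta>1 (I2 (1 - \<mu>))"
    by (simp_all only: I equilibria_in_reflect)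
  have reflect_ex: "(\<exists>x. P x) \<longleftrightarrow> (\<exists>x. P (- x))" for P :: "real \<Rightarrow> bool"
    by (metis minus_minus)
  have star: "beta1_star (- x) (1 - \<mu>) = beta2_star x \<mu>" "beta2_star (- x) (1 - \<mu>) = beta1_star x \<mu>" for x
    by (rule beta_star_reflect)+
  have ends: "- x < - (1 - \<mu>) \<longleftrightarrow> 1 - \<mu> < x" "- (1 - \<mu>) < - x \<longleftrightarrow> x < 1 - \<mu>"
    "- x < x_r1 (1 - \<mu>) \<longleftrightarrow> x_r2 \<mu> < x" for x
    by (auto simp: x_r2_def)
  have outer: "(\<exists>p. p \<in> equilibria_in (1 - \<mu>) \<beta>2 \<beta>1 (I1 (1 - \<mu>))) \<longleftrightarrow>
       (\<exists>x. 1 - \<mu> < x \<and> - beta2_star x \<mu> \<le> \<beta>2 \<and> \<beta>2 < 0 \<and> beta1_star x \<mu> \<le> \<beta>1)"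
    unfolding outer_equilibrium_iff[OF nu b] by (subst reflect_ex) (simp only: star ends)
  have inner: "(\<exists>p. p \<in> equilibria_in (1 - \<mu>) \<beta>2 \<beta>1 (I2 (1 - \<mu>))) \<longleftrightarrow>
       (\<exists>x. x_r2 \<mu> < x \<and> x < 1 - \<mu> \<and> beta2_star x \<mu> \<le> \<beta>2 \<and> \<beta>2 < 0 \<and>
               beta2_star x \<mu> / (beta2_star x \<mu> - 1) < \<beta>1 \<and> \<beta>1 \<le> beta1_star x \<mu>)"
    unfolding inner_equilibrium_iff[OF nu R2] by (subst reflect_ex) (simp only: star ends, blast)
  show ?thesis
    unfolding eqv outer[symmetric] inner[symmetric]
    using region2[OF nu R2] by (auto simp: finite_card_image_le)
qed

theorem theorem4p4:
  fixes \<mu> \<beta>1 \<beta>2 :: real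
  assumes "0 < \<mu>" and "\<mu> \<le> 1 / 2"
  shows
    "((\<beta>1, \<beta>2) \<in> R2' \<longrightarrow>
        finite (equilibria_in \<mu> \<beta>1 \<beta>2 (I1 \<mu>)) \<and> card (equilibria_in \<mu> \<beta>1 \<beta>2 (I1 \<mu>)) \<le> 2 \<and>
        finite (equilibria_in \<mu> \<beta>1 \<beta>2 (I2 \<mu>)) \<and> card (equilibria_in \<mu> \<beta>1 \<beta>2 (I2 \<mu>)) \<le> 2 \<and>
        ((\<exists>p. p \<in> equilibria_in \<mu> \<beta>1 \<beta>2 (I1 \<mu>)) \<longleftrightarrow>
          (\<exists>x. x < - \<mu> \<and>
               - beta1_star x \<mu> \<le> \<beta>1 \<and> \<beta>1 < 0 \<and>
               beta2_star x \<mu> \<le> \<beta>2)) \<and>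
        ((\<exists>p. p \<in> equilibria_in \<mu> \<beta>1 \<beta>2 (I2 \<mu>)) \<longleftrightarrow>
          (\<exists>x. - \<mu> < x \<and> x < x_r1 \<mu> \<and>
               beta1_star x \<mu> \<le> \<beta>1 \<and> \<beta>1 < 0 \<and>
               beta1_star x \<mu> / (beta1_star x \<mu> - 1) < \<beta>2 \<and> \<beta>2 \<le> beta2_star x \<mu>)))
     \<and>
     ((\<beta>1, \<beta>2) \<in> R4' \<longrightarrow>
        finite (equilibria_in \<mu> \<beta>1 \<beta>2 (I3 \<mu>)) \<and> card (equilibria_in \<mu> \<beta>1 \<beta>2 (I3 \<mu>)) \<le> 2 \<and>
        finite (equilibria_in \<mu> \<beta>1 \<beta>2 (I2 \<mu>)) \<and> card (equilibria_in \<mu> \<beta>1 \<beta>2 (I2 \<mu>)) \<le> 2 \<and>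
        ((\<exists>p. p \<in> equilibria_in \<mu> \<beta>1 \<beta>2 (I3 \<mu>)) \<longleftrightarrow>
          (\<exists>x. 1 - \<mu> < x \<and>
               - beta2_star x \<mu> \<le> \<beta>2 \<and> \<beta>2 < 0 \<and>
               beta1_star x \<mu> \<le> \<beta>1)) \<and>
        ((\<exists>p. p \<in> equilibria_in \<mu> \<beta>1 \<beta>2 (I2 \<mu>)) \<longleftrightarrow>
          (\<exists>x. x_r2 \<mu> < x \<and> x < 1 - \<mu> \<and>
               beta2_star x \<mu> \<le> \<beta>2 \<and> \<beta>2 < 0 \<and>
               beta2_star x \<mu> / (beta2_star x \<mu> - 1) < \<beta>1 \<and> \<beta>1 \<le> beta1_star x \<mu>)))"
  using assms by (intro conjI[of "_ \<longrightarrow> _"] impI region2 region4) auto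

end
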